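(* For dissimilarity parameters $\sigma_n\in[0,1]$, $n\in[N]$, suppose that the piecewise linear approximators $\widehat{f^n}$ and $\widehat{g^n}$ ($n\in[N]$) are constructed satisfying a given relative approximation error $\epsilon>0$, i.e. for all $n\in[N]$ $$\max_{t\in[L_n,U_n]}\frac{\widehat{f^n}(t)-f^n(t)}{f^n(t)}\le\epsilon,\qquad \max_{t\in[L_n,U_n]}\frac{g^n(t)-\widehat{g^n}(t)}{g^n(t)}\le\epsilon .$$ Let $x^*$ be an optimal solution to the original problem $\max_{x\in X}F(x)$ and let $\widehat x$ be an optimal solution to the approximate problem (Assort-LFP) described in the context. Then $$F(x^* )\le\widehat F(\widehat x)\le\frac{1+\epsilon}{1-\epsilon}F(x^* )\qquad\text{and}\qquad \frac{1-\epsilon}{1+\epsilon}F(x^* )\le F(\widehat x)\le F(x^* ).$$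
   Context: Setting (Cross-Nested Logit assortment problem): there are $m$ products and $N$ nests; product $i$ has revenue $r_i$ and preference weight $v_i$. Without loss of generality every nest is $S_n=[m]=\{1,\dots,m\}$, and $\alpha_{in}\ge0$ is the level of membership of product $i$ in nest $n$ (zero if $i$ is not a member), with $\sum_{n\in[N]}\alpha_{in}=1$. $v_{0n}$ is the preference weight of leaving nest $n$ without purchase and $\sigma_n$ is the dissimilarity parameter of nest $n$. The feasible set is $X=\{x\in\{0,1\}^m: Ax\le b\}$. Put $W_n=W_n(x)=v_{0n}+\sum_{i\in[m]}\alpha_{in}x_iv_i$ and $$F(x)=\frac{\sum_{i\in[m]}\sum_{n\in[N]}W_n^{\sigma_n-1}\alpha_{in}x_ir_iv_i}{\sum_{n\in[N]}W_n^{\sigma_n}}.$$ $L_n$ and $U_n$ are the minimum and maximum of $W_n(x)$ over $x\in X$, and on $[L_n,U_n]$, $f^n(t)=t^{\sigma_n-1}$, $g^n(t)=t^{\sigma_n}$. Approximators: for each $n$, $[L_n,U_n]$ is partitioned into $K_n$ successive closed sub-intervals $[c^n_k,c^n_{k+1}]$, $k\in[K_n]$, with $c^n_1=L_n$, $c^n_{K_n+1}=U_n$; $\widehat{f^n}$ and $\widehat{g^n}$ are affine on each sub-interval and coincide with $f^n$, resp. $g^n$, at all breakpoints $c^n_k$. Let $\Delta_{nk}=c^n_{k+1}-c^n_k$, $\gamma^{fn}_k=(f^n(c^n_{k+1})-f^n(c^n_k))/\Delta_{nk}$, $\gamma^{gn}_k=(g^n(c^n_{k+1})-g^n(c^n_k))/\Delta_{nk}$.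 (Assort-LFP): with $a_{in}=\alpha_{in}r_iv_if^n(L_n)$, $b_{ink}=\alpha_{in}r_iv_i\gamma^{fn}_k\Delta_{nk}$, $c=\sum_{n}g^n(L_n)$, $d_{nk}=\Delta_{nk}\gamma^{gn}_k$, maximize over $x\in X$, $y_{nk}\in\{0,1\}$, $z_{nk}\in[0,1]$, $s_{ink}\in[0,1]$ ($i\in[m],n\in[N],k\in[K_n]$) $$\widehat F(x)=\frac{\sum_{i,n}a_{in}x_i+\sum_{i,n,k}b_{ink}s_{ink}}{c+\sum_{n,k}d_{nk}z_{nk}}$$ subject to: $v_{0n}+\sum_{i}\alpha_{in}x_iv_i=L_n+\sum_{k\in[K_n]}\Delta_{nk}z_{nk}$ for all $n$; $y_{n,k+1}\le y_{nk}\le z_{nk}$ and $z_{n,k+1}\le y_{nk}$ for all $n$ and $k\in[K_n-1]$; $s_{ink}\le x_i$, $s_{ink}\le z_{nk}$, $s_{ink}\ge x_i+z_{nk}-1$ for all $i,n,k$. Here $\widehat F(\widehat x)$ is the optimal value; by construction $\widehat F(x)$ equals $\frac{\sum_{i,n}\widehat{f^n}(W_n)\alpha_{in}x_ir_iv_i}{\sum_n\widehat{g^n}(W_n)}$.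
   Formalization: The formal theorem also assumes ε<1 (the factor (1+ε)/(1−ε) is undefined at ε=1 and the upper bound fails for ε>1 when F(x* )>0), nonnegative revenues r_i and weights v_i, v_0n, and L_n>0 so that f^n and the relative errors are defined. *)

theory Defs
  imports "HOL-Analysis.Analysis"
begin

text \<open>
  Data of a Cross-Nested Logit assortment problem. Products, nests and linear constraints are
  indexed by arbitrary finite types. An assortment is a \<open>0/1\<close> vector over the products.
\<close>

record ('m, 'n, 'p) cnl =
  revenue :: "'m::finite \<Rightarrow> real"
  weight :: "'m \<Rightarrow> real"
  outside_weight :: "'n::finite \<Rightarrow> real"
  membership :: "'m \<Rightarrow> 'n \<Rightarrow> real"
  dissim :: "'n \<Rightarrow> real"
  constr_mat :: "real ^ 'm ^ ('p::finite)"
  constr_rhs :: "real ^ 'p"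

definition feasible :: "('m::finite, 'n::finite, 'p::finite) cnl \<Rightarrow> (real ^ 'm) set" where
  "feasible P = {x. (\<forall>i. x $ i \<in> {0, 1}) \<and> constr_mat P *v x \<le> constr_rhs P}"

definition W :: "('m::finite, 'n::finite, 'p::finite) cnl \<Rightarrow> 'n \<Rightarrow> real ^ 'm \<Rightarrow> real" where
  "W P n x = outside_weight P n + (\<Sum>i\<in>UNIV. membership P i n * x $ i * weight P i)"

definition expected_revenue :: "('m::finite, 'n::finite, 'p::finite) cnl \<Rightarrow> real ^ 'm \<Rightarrow> real" where
  "expected_revenue P x =
     (\<Sum>i\<in>UNIV. \<Sum>n\<in>UNIV.
        W P n x powr (dissim P n - 1) * membership P i n * x $ i * revenue P i * weight P i)
     / (\<Sum>n\<in>UNIV. W P n x powr dissim P n)"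

definition L :: "('m::finite, 'n::finite, 'p::finite) cnl \<Rightarrow> 'n \<Rightarrow> real" where
  "L P n = Min (W P n ` feasible P)"

definition U :: "('m::finite, 'n::finite, 'p::finite) cnl \<Rightarrow> 'n \<Rightarrow> real" where
  "U P n = Max (W P n ` feasible P)"

definition fn :: "('m::finite, 'n::finite, 'p::finite) cnl \<Rightarrow> 'n \<Rightarrow> real \<Rightarrow> real" where
  "fn P n t = t powr (dissim P n - 1)"

definition gn :: "('m::finite, 'n::finite, 'p::finite) cnl \<Rightarrow> 'n \<Rightarrow> real \<Rightarrow> real" where
  "gn P n t = t powr dissim P n"

text \<open>
  \<open>brk 1 < \<dots> < brk (K + 1)\<close> are the breakpoints of a partition of \<open>[lo, hi]\<close> into \<open>K\<close> successive
  closed sub-intervals. \<open>K = 0\<close> occurs exactly in the degenerate case \<open>lo = hi\<close>.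
\<close>

definition is_partition :: "real \<Rightarrow> real \<Rightarrow> nat \<Rightarrow> (nat \<Rightarrow> real) \<Rightarrow> bool" where
  "is_partition lo hi K brk \<longleftrightarrow>
     brk 1 = lo \<and> brk (K + 1) = hi \<and> (\<forall>k\<in>{1..K}. brk k < brk (k + 1))"

definition pw_linear_interpolant ::
    "nat \<Rightarrow> (nat \<Rightarrow> real) \<Rightarrow> (real \<Rightarrow> real) \<Rightarrow> (real \<Rightarrow> real) \<Rightarrow> bool" where
  "pw_linear_interpolant K brk h hhat \<longleftrightarrow>
     (\<forall>k\<in>{1..K}. \<exists>a b. \<forall>t\<in>{brk k..brk (k + 1)}. hhat t = a * t + b) \<and>
     (\<forall>k\<in>{1..K + 1}. hhat (brk k) = h (brk k))"

definition width :: "('n \<Rightarrow> nat \<Rightarrow> real) \<Rightarrow> 'n \<Rightarrow> nat \<Rightarrow> real" where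
  "width brk n k = brk n (k + 1) - brk n k"

definition slope :: "('n \<Rightarrow> real \<Rightarrow> real) \<Rightarrow> ('n \<Rightarrow> nat \<Rightarrow> real) \<Rightarrow> 'n \<Rightarrow> nat \<Rightarrow> real" where
  "slope h brk n k = (h n (brk n (k + 1)) - h n (brk n k)) / width brk n k"

text \<open>
  Decision variables of the linear fractional program: \<open>(x, y, z, s)\<close> with
  \<open>y n k\<close>, \<open>z n k\<close>, \<open>s i n k\<close> relevant only for \<open>1 \<le> k \<le> K n\<close>; values at other \<open>k\<close> are unconstrained
  and do not enter the objective.
\<close>

type_synonym ('m, 'n) lfp_vars =
  "(real ^ 'm) \<times> ('n \<Rightarrow> nat \<Rightarrow> real) \<times> ('n \<Rightarrow> nat \<Rightarrow> real) \<times> ('m \<Rightarrow> 'n \<Rightarrow> nat \<Rightarrow> real)"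

fun lfp_objective ::
    "('m::finite, 'n::finite, 'p::finite) cnl \<Rightarrow> ('n \<Rightarrow> nat) \<Rightarrow> ('n \<Rightarrow> nat \<Rightarrow> real) \<Rightarrow>
     ('m, 'n) lfp_vars \<Rightarrow> real" where
  "lfp_objective P K brk (x, y, z, s) =
     (let a = (\<lambda>i n. membership P i n * revenue P i * weight P i * fn P n (L P n));
          b = (\<lambda>i n k. membership P i n * revenue P i * weight P i
                 * slope (fn P) brk n k * width brk n k);
          c = (\<Sum>n\<in>UNIV. gn P n (L P n));
          d = (\<lambda>n k. width brk n k * slope (gn P) brk n k)
      in ((\<Sum>i\<in>UNIV. \<Sum>n\<in>UNIV. a i n * x $ i)
            + (\<Sum>i\<in>UNIV. \<Sum>n\<in>UNIV. \<Sum>k\<in>{1..K n}. b i n k * s i n k))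
         / (c + (\<Sum>n\<in>UNIV. \<Sum>k\<in>{1..K n}. d n k * z n k)))"

fun lfp_feasible ::
    "('m::finite, 'n::finite, 'p::finite) cnl \<Rightarrow> ('n \<Rightarrow> nat) \<Rightarrow> ('n \<Rightarrow> nat \<Rightarrow> real) \<Rightarrow>
     ('m, 'n) lfp_vars \<Rightarrow> bool" where
  "lfp_feasible P K brk (x, y, z, s) \<longleftrightarrow>
     x \<in> feasible P \<and>
     (\<forall>n. \<forall>k\<in>{1..K n}. y n k \<in> {0, 1} \<and> z n k \<in> {0..1} \<and> (\<forall>i. s i n k \<in> {0..1})) \<and>
     (\<forall>n. outside_weight P n + (\<Sum>i\<in>UNIV. membership P i n * x $ i * weight P i)
          = L P n + (\<Sum>k\<in>{1..K n}. width brk n k * z n k)) \<and>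
     (\<forall>n. \<forall>k\<in>{1..<K n}. y n (k + 1) \<le> y n k \<and> y n k \<le> z n k \<and> z n (k + 1) \<le> y n k) \<and>
     (\<forall>i n. \<forall>k\<in>{1..K n}. s i n k \<le> x $ i \<and> s i n k \<le> z n k \<and> s i n k \<ge> x $ i + z n k - 1)"

end

theory Submission
  imports Defs
begin

text \<open>
  Since \<open>0 \<le> \<sigma>\<^sub>n \<le> 1\<close>, each \<open>f\<^sup>n\<close> is convex and each \<open>g\<^sup>n\<close> concave, so interpolation overestimates
  \<open>f\<^sup>n\<close> and underestimates \<open>g\<^sup>n\<close>. The error bounds then give \<open>F \<le> Fhat \<le> ((1 + \<epsilon>) / (1 - \<epsilon>)) F\<close> pointwise,
  and the claim follows by comparing the two maximisers. The link with the linear fractional program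
  is that the binary variables force \<open>z\<close> to be filled greedily from the left, which makes
  the objective equal to \<open>Fhat\<close>, and that every assortment admits such a filling.
\<close>

section \<open>Greedy fillings of the sub-intervals\<close>

text \<open>What remains of the constraints on \<open>z\<close> once the binary variables
  \<open>y\<close> are eliminated.\<close>

definition filled :: "nat \<Rightarrow> (nat \<Rightarrow> real) \<Rightarrow> bool" where
  "filled K z \<longleftrightarrow> (\<forall>k\<in>{1..K}. 0 \<le> z k \<and> z k \<le> 1) \<and> (\<forall>k\<in>{1..<K}. 0 < z (Suc k) \<longrightarrow> z k = 1)"

text \<open>A positive entry forces its predecessor to be 1, hence positive, so fullness propagates
  down to index 1.\<close>

lemma filled_all_one:
  assumes "filled (Suc K) z" "0 < z (Suc K)" "k \<in> {1..K}"
  shows "z k = 1"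
  using assms
proof (induction K)
  case (Suc K)
  have one: "z (Suc K) = 1"
    using Suc.prems by (auto simp: filled_def)
  show ?case
  proof (cases "k = Suc K")
    case False
    then show ?thesis
      using Suc one by (auto simp: filled_def)
  qed (use one in simp)
qed auto

section \<open>Piecewise linear interpolants\<close>

lemma pw_linear_interpolant_SucD:
  assumes "pw_linear_interpolant (Suc K) brk h hhat"
  shows "pw_linear_interpolant K brk h hhat"
  using assms by (auto simp: pw_linear_interpolant_def)

text \<open>Reduces the concave case to the convex one.\<close>

lemma pw_linear_interpolant_minus:
  assumes "pw_linear_interpolant K brk h hhat"
  shows "pw_linear_interpolant K brk (\<lambda>t. - h t) (\<lambda>t. - hhat t)"
proof -
  have "\<exists>a' b'. \<forall>t\<in>{brk k..brk (k + 1)}. - hhat t = a' * t + b'" if k: "k \<in> {1..K}" for k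
  proof -
    obtain a b where "\<forall>t\<in>{brk k..brk (k + 1)}. hhat t = a * t + b"
      using assms k unfolding pw_linear_interpolant_def by blast
    then have "\<forall>t\<in>{brk k..brk (k + 1)}. - hhat t = - a * t + - b"
      by simp
    then show ?thesis by blast
  qed
  then show ?thesis
    using assms by (auto simp: pw_linear_interpolant_def)
qed

lemma pw_linear_interpolant_segment:
  assumes "pw_linear_interpolant K brk h hhat" "k \<in> {1..K}" "brk k < brk (k + 1)"
    and "t \<in> {brk k..brk (k + 1)}"
  shows "hhat t = h (brk k) + (h (brk (k + 1)) - h (brk k)) / (brk (k + 1) - brk k) * (t - brk k)"
proof -
  obtain a b where ab: "\<forall>t\<in>{brk k..brk (k + 1)}. hhat t = a * t + b"
    using assms(1,2) unfolding pw_linear_interpolant_def by blast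
  have "hhat (brk k) = h (brk k)" "hhat (brk (k + 1)) = h (brk (k + 1))"
    using assms(1,2) unfolding pw_linear_interpolant_def by auto
  then have "h (brk k) = a * brk k + b" "h (brk (k + 1)) = a * brk (k + 1) + b"
    using ab assms(3) by force+
  then have "h (brk (k + 1)) - h (brk k) = a * (brk (k + 1) - brk k)"
    by (simp add: algebra_simps)
  then have "(h (brk (k + 1)) - h (brk k)) / (brk (k + 1) - brk k) = a"
    using assms(3) by simp
  moreover have "hhat t = h (brk k) + a * (t - brk k)"
    using ab assms(4) \<open>h (brk k) = a * brk k + b\<close> by (simp add: algebra_simps)
  ultimately show ?thesis by simp
qed

text \<open>Although \<open>hhat\<close> is only piecewise affine, a greedy filling makes its value
  affine in \<open>z\<close>. If the last entry is 0, the last terms vanish and induction applies;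
  otherwise all earlier entries are 1, both sums telescope, and the point lies in the last
  sub-interval, where \<open>hhat\<close> is the chord.\<close>

lemma interpolant_filled_eq:
  assumes "pw_linear_interpolant K brk h hhat" "\<And>k. k \<in> {1..K} \<Longrightarrow> brk k < brk (k + 1)"
    and "filled K z"
  shows "hhat (brk 1 + (\<Sum>k\<in>{1..K}. (brk (k + 1) - brk k) * z k))
       = h (brk 1) + (\<Sum>k\<in>{1..K}. (h (brk (k + 1)) - h (brk k)) * z k)"
  using assms
proof (induction K)
  case 0
  then show ?case by (simp add: pw_linear_interpolant_def)
next
  case (Suc K)
  have nonneg: "0 \<le> z (Suc K)" "z (Suc K) \<le> 1"
    using Suc.prems(3) by (auto simp: filled_def)
  have filled: "filled K z"
    using Suc.prems(3) by (auto simp: filled_def)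
  show ?case
  proof (cases "z (Suc K) = 0")
    case True
    have "hhat (brk 1 + (\<Sum>k\<in>{1..K}. (brk (k + 1) - brk k) * z k))
       = h (brk 1) + (\<Sum>k\<in>{1..K}. (h (brk (k + 1)) - h (brk k)) * z k)"
      by (rule Suc.IH[OF pw_linear_interpolant_SucD[OF Suc.prems(1)] _ filled])
        (use Suc.prems(2) in simp)
    then show ?thesis using True by simp
  next
    case False
    then have one: "z k = 1" if "k \<in> {1..K}" for k
      using filled_all_one[OF Suc.prems(3)] nonneg that by simp
    \<comment> \<open>A general \<open>u\<close> covers both the breakpoints and the values of
      \<open>h\<close> at them.\<close>
    have tele: "(\<Sum>k\<in>{1..K}. (u (k + 1) - u k) * z k) = u (Suc K) - u 1" for u :: "nat \<Rightarrow> real"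
      using sum_Suc_diff[of 1 K u] one by simp
    let ?w = "brk (Suc K + 1) - brk (Suc K)"
    let ?t = "brk (Suc K) + ?w * z (Suc K)"
    have w: "0 < ?w"
      using Suc.prems(2)[of "Suc K"] by simp
    have "0 \<le> ?w * z (Suc K)" "?w * z (Suc K) \<le> ?w"
      using w nonneg mult_left_le[of "z (Suc K)" ?w] by simp_all
    moreover have "c \<in> {a..b}" if "0 \<le> c - a" "c - a \<le> b - a" for a b c :: real
      using that by simp
    ultimately have t: "?t \<in> {brk (Suc K)..brk (Suc K + 1)}"
      by (metis add_diff_cancel_left')
    have "hhat ?t = h (brk (Suc K)) + (h (brk (Suc K + 1)) - h (brk (Suc K))) / ?w * (?t - brk (Suc K))"
      by (rule pw_linear_interpolant_segment[OF Suc.prems(1)]) (use w t in auto)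
    also have "\<dots> = h (brk (Suc K)) + (h (brk (Suc K + 1)) - h (brk (Suc K))) * z (Suc K)"
      using w by simp
    finally show ?thesis
      using tele[of brk] tele[of "\<lambda>k. h (brk k)"] by simp
  qed
qed

text \<open>On each sub-interval the interpolant is the chord, and a convex function lies below its
  chords; the induction peels off the last sub-interval.\<close>

lemma convex_le_interpolant:
  assumes "pw_linear_interpolant K brk h hhat" "\<And>k. k \<in> {1..K} \<Longrightarrow> brk k < brk (k + 1)"
    and "convex_on {brk 1..brk (K + 1)} h" "t \<in> {brk 1..brk (K + 1)}"
  shows "h t \<le> hhat t"
  using assms
proof (induction K)
  case 0
  then have "t = brk 1" by simp
  with 0 show ?case by (simp add: pw_linear_interpolant_def)
next
  case (Suc K)
  have step: "brk (Suc K) < brk (Suc K + 1)"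
    using Suc.prems(2)[of "Suc K"] by simp
  show ?case
  proof (cases "t \<le> brk (Suc K)")
    case True
    have "convex_on {brk 1..brk (K + 1)} h"
      by (rule convex_on_subset[OF Suc.prems(3)]) (use step in auto)
    then show ?thesis
      using Suc.IH[OF pw_linear_interpolant_SucD[OF Suc.prems(1)]] Suc.prems(2,4) True by simp
  next
    case False
    then have t: "t \<in> {brk (Suc K)..brk (Suc K + 1)}"
      using Suc.prems(4) by simp
    \<comment> \<open>Telescoping the nonnegative widths places the last sub-interval inside the
      domain of convexity.\<close>
    have "brk 1 \<le> brk (Suc K)"
      using sum_Suc_diff[of 1 K brk] sum_nonneg[of "{1..K}" "\<lambda>k. brk (Suc k) - brk k"]
        Suc.prems(2) by (simp add: less_imp_le)
    then have "convex_on {brk (Suc K)..brk (Suc K + 1)} h"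
      by (intro convex_on_subset[OF Suc.prems(3)]) auto
    from convex_onD_Icc'[OF this t]
    show ?thesis
      using pw_linear_interpolant_segment[OF Suc.prems(1) _ step t] by simp
  qed
qed

lemma concave_ge_interpolant:
  assumes "pw_linear_interpolant K brk h hhat" "\<And>k. k \<in> {1..K} \<Longrightarrow> brk k < brk (k + 1)"
    and "concave_on {brk 1..brk (K + 1)} h" "t \<in> {brk 1..brk (K + 1)}"
  shows "hhat t \<le> h t"
  using convex_le_interpolant[OF pw_linear_interpolant_minus[OF assms(1)] assms(2)] assms(3,4)
  by (simp add: concave_on_def)

section \<open>Convexity and concavity of power functions\<close>

text \<open>The second derivative carries the factor \<open>p * (p - 1)\<close>, a product of two
  nonpositive numbers. Used with \<open>p\<close> = \<sigma> - 1.\<close>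

lemma convex_on_powr_nonpos:
  fixes p :: real
  assumes "p \<le> 0"
  shows "convex_on {0<..} (\<lambda>x. x powr p)"
proof (rule f''_ge0_imp_convex)
  fix x :: real assume "x \<in> {0<..}"
  then show "((\<lambda>x. x powr p) has_real_derivative p * x powr (p - 1)) (at x)"
    and "((\<lambda>x. p * x powr (p - 1)) has_real_derivative p * ((p - 1) * x powr (p - 2))) (at x)"
    by (auto intro!: derivative_eq_intros simp: algebra_simps)
  show "0 \<le> p * ((p - 1) * x powr (p - 2))"
    using assms by (simp add: mult_nonpos_nonpos mult_nonpos_nonneg)
qed simp

text \<open>Here \<open>p * (p - 1)\<close> is nonpositive. Used with \<open>p\<close> =
  \<sigma>.\<close>

lemma concave_on_powr:
  fixes p :: real
  assumes "0 \<le> p" "p \<le> 1"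
  shows "concave_on {0<..} (\<lambda>x. x powr p)"
proof (rule f''_le0_imp_concave)
  fix x :: real assume "x \<in> {0<..}"
  then show "((\<lambda>x. x powr p) has_real_derivative p * x powr (p - 1)) (at x)"
    and "((\<lambda>x. p * x powr (p - 1)) has_real_derivative p * ((p - 1) * x powr (p - 2))) (at x)"
    by (auto intro!: derivative_eq_intros simp: algebra_simps)
  show "p * ((p - 1) * x powr (p - 2)) \<le> 0"
    using assms by (simp add: mult_nonneg_nonpos mult_nonpos_nonneg)
qed simp

section \<open>Feasible assortments and the revenue ratio\<close>

text \<open>Finiteness gives \<open>Min\<close> and \<open>Max\<close> in \<open>L\<close> and
  \<open>U\<close> their intended meaning.\<close>

lemma finite_feasible: "finite (feasible P)"
proof -
  have "feasible P \<subseteq> vec_lambda ` (UNIV \<rightarrow>\<^sub>E {0, 1})"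
  proof
    fix x assume "x \<in> feasible P"
    then have "vec_nth x \<in> UNIV \<rightarrow>\<^sub>E {0, 1}"
      by (auto simp: feasible_def)
    then show "x \<in> vec_lambda ` (UNIV \<rightarrow>\<^sub>E {0, 1})"
      by (metis image_eqI vec_nth_inverse)
  qed
  then show ?thesis
    by (rule finite_subset) (intro finite_imageI finite_PiE; simp)
qed

lemma W_bounds:
  assumes "x \<in> feasible P"
  shows "W P n x \<in> {L P n..U P n}"
  using assms finite_feasible[of P] by (auto simp: L_def U_def)

text \<open>Common form of the exact and the approximate objective, so that the two can be compared
  by varying \<open>f\<close> and \<open>g\<close> alone.\<close>

definition revenue_ratio ::
    "('m::finite, 'n::finite, 'p::finite) cnl \<Rightarrow> ('n \<Rightarrow> real \<Rightarrow> real) \<Rightarrow> ('n \<Rightarrow> real \<Rightarrow> real) \<Rightarrow>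
     real ^ 'm \<Rightarrow> real" where
  "revenue_ratio P f g x =
     (\<Sum>i\<in>UNIV. \<Sum>n\<in>UNIV. f n (W P n x) * membership P i n * x $ i * revenue P i * weight P i)
     / (\<Sum>n\<in>UNIV. g n (W P n x))"

lemma expected_revenue_eq: "expected_revenue P = revenue_ratio P (fn P) (gn P)"
  by (simp add: fun_eq_iff expected_revenue_def revenue_ratio_def fn_def gn_def)

section \<open>The linear fractional program\<close>

text \<open>If \<open>z n (Suc k)\<close> is positive, so is the binary \<open>y n k\<close> above
  it; thus \<open>y n k\<close> is 1 and pushes \<open>z n k\<close> up to 1.\<close>

lemma filled_if_lfp_feasible:
  assumes "lfp_feasible P K brk (x, y, z, s)"
  shows "filled (K n) (z n)"
proof -
  have "z n k = 1" if "k \<in> {1..<K n}" "0 < z n (Suc k)" for k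
  proof -
    have "k \<in> {1..K n}" using that by simp
    then have "y n k \<in> {0, 1}" "z n k \<le> 1" "y n k \<le> z n k" "z n (Suc k) \<le> y n k"
      using assms that(1) by auto
    then show ?thesis using that(2) by auto
  qed
  then show ?thesis
    using assms by (auto simp: filled_def)
qed

text \<open>The equality constraint writes \<open>W\<close> as the left endpoint plus a greedy
  filling, which turns the interpolants at \<open>W\<close> into affine expressions in
  \<open>z\<close>; the variables \<open>s\<close> supply the products of \<open>x\<close> and
  \<open>z\<close>.\<close>

lemma lfp_objective_eq:
  assumes feas: "lfp_feasible P K brk (x, y, z, s)"
    and partition: "\<And>n. is_partition (L P n) (U P n) (K n) (brk n)"
    and fhat: "\<And>n. pw_linear_interpolant (K n) (brk n) (fn P n) (fhat n)"
    and ghat: "\<And>n. pw_linear_interpolant (K n) (brk n) (gn P n) (ghat n)"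
  shows "lfp_objective P K brk (x, y, z, s) = revenue_ratio P fhat ghat x"
proof -
  have brk: "brk n 1 = L P n" "\<And>k. k \<in> {1..K n} \<Longrightarrow> brk n k < brk n (k + 1)" for n
    using partition[of n] by (auto simp: is_partition_def)
  have W: "W P n x = brk n 1 + (\<Sum>k\<in>{1..K n}. (brk n (k + 1) - brk n k) * z n k)" for n
    using feas brk by (simp add: W_def width_def)
  have hat: "hhat n (W P n x)
      = h n (L P n) + (\<Sum>k\<in>{1..K n}. width brk n k * slope h brk n k * z n k)"
    if "\<And>n. pw_linear_interpolant (K n) (brk n) (h n) (hhat n)" for h hhat n
  proof -
    have "(\<Sum>k\<in>{1..K n}. width brk n k * slope h brk n k * z n k)
        = (\<Sum>k\<in>{1..K n}. (h n (brk n (k + 1)) - h n (brk n k)) * z n k)"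
      using brk(2)[of _ n] by (intro sum.cong) (fastforce simp: slope_def width_def)+
    then show ?thesis
      using interpolant_filled_eq[OF that brk(2) filled_if_lfp_feasible[OF feas]]
      unfolding W by (simp only: brk(1))
  qed
  \<comment> \<open>Since \<open>x $ i\<close> is binary, the linear bounds are exact: for 0 they
    squeeze \<open>s\<close> to 0, for 1 they squeeze it to \<open>z\<close>.\<close>
  have s: "s i n k = x $ i * z n k" if "k \<in> {1..K n}" for i n k
  proof -
    have "x $ i \<in> {0, 1}" "0 \<le> s i n k" "s i n k \<le> x $ i" "s i n k \<le> z n k" "x $ i + z n k - 1 \<le> s i n k"
      using feas that by (auto simp: feasible_def)
    then show ?thesis by auto
  qed
  let ?a = "\<lambda>i n. membership P i n * revenue P i * weight P i * fn P n (L P n)"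
  let ?b = "\<lambda>i n k. membership P i n * revenue P i * weight P i * slope (fn P) brk n k * width brk n k"
  have "?a i n * x $ i + (\<Sum>k\<in>{1..K n}. ?b i n k * s i n k)
      = fhat n (W P n x) * membership P i n * x $ i * revenue P i * weight P i" for i n
  proof -
    have "(\<Sum>k\<in>{1..K n}. ?b i n k * s i n k)
        = membership P i n * revenue P i * weight P i * x $ i
            * (\<Sum>k\<in>{1..K n}. width brk n k * slope (fn P) brk n k * z n k)"
      unfolding sum_distrib_left by (intro sum.cong) (auto simp: s)
    then show ?thesis
      by (simp add: hat[OF fhat] algebra_simps)
  qed
  then have num: "(\<Sum>i\<in>UNIV. \<Sum>n\<in>UNIV. ?a i n * x $ i)
        + (\<Sum>i\<in>UNIV. \<Sum>n\<in>UNIV. \<Sum>k\<in>{1..K n}. ?b i n k * s i n k)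
      = (\<Sum>i\<in>UNIV. \<Sum>n\<in>UNIV. fhat n (W P n x) * membership P i n * x $ i * revenue P i * weight P i)"
    by (simp flip: sum.distrib)
  have den: "(\<Sum>n\<in>UNIV. gn P n (L P n))
        + (\<Sum>n\<in>UNIV. \<Sum>k\<in>{1..K n}. width brk n k * slope (gn P) brk n k * z n k)
      = (\<Sum>n\<in>UNIV. ghat n (W P n x))"
    by (simp add: hat[OF ghat] sum.distrib)
  show ?thesis
    unfolding lfp_objective.simps Let_def num den revenue_ratio_def ..
qed

text \<open>Needed to compare the optimum of the program with the approximate value at
  \<open>x_opt\<close>. The witness \<open>z\<close> is the fraction of each sub-interval lying
  below \<open>W\<close>, and \<open>y\<close> marks the sub-intervals entirely below it.\<close>

lemma lfp_feasible_exists: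
  assumes x: "x \<in> feasible P"
    and partition: "\<And>n. is_partition (L P n) (U P n) (K n) (brk n)"
  obtains y z s where "lfp_feasible P K brk (x, y, z, s)"
proof -
  \<comment> \<open>Breakpoints truncated at \<open>W\<close>: their increments are the covered
    lengths.\<close>
  define m where "m n k = min (W P n x) (brk n k)" for n k
  define z where "z n k = (m n (k + 1) - m n k) / width brk n k" for n k
  define y where "y n k = (if brk n (k + 1) \<le> W P n x then 1 else 0 :: real)" for n k
  define s where "s i n k = x $ i * z n k" for i n k
  have brk: "brk n 1 = L P n" "brk n (K n + 1) = U P n"
    "\<And>k. k \<in> {1..K n} \<Longrightarrow> brk n k < brk n (k + 1)" for n
    using partition[of n] by (auto simp: is_partition_def)
  have z01: "0 \<le> z n k" "z n k \<le> 1" if "k \<in> {1..K n}" for n k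
    using brk(3)[OF that] by (auto simp: z_def m_def width_def divide_simps)
  have y_le_z: "y n k \<le> z n k" if "k \<in> {1..K n}" for n k
    using brk(3)[OF that] by (auto simp: y_def z_def m_def width_def divide_simps)
  \<comment> \<open>If \<open>y n k\<close> is 0, then \<open>W\<close> lies below
    \<open>brk n (k + 1)\<close>, so both truncated breakpoints equal \<open>W\<close> and
    \<open>z n (k + 1)\<close> vanishes.\<close>
  have z_le_y: "z n (k + 1) \<le> y n k" if "k + 1 \<in> {1..K n}" for n k
    using brk(3)[OF that] z01(2)[OF that] by (auto simp: y_def z_def m_def)
  have y_mono: "y n (k + 1) \<le> y n k" if "k + 1 \<in> {1..K n}" for n k
    using brk(3)[OF that] by (auto simp: y_def)
  have "(\<Sum>k\<in>{1..K n}. width brk n k * z n k) = (\<Sum>k\<in>{1..K n}. m n (Suc k) - m n k)" for n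
    using brk(3)[of _ n] by (intro sum.cong) (fastforce simp: z_def width_def)+
  then have "(\<Sum>k\<in>{1..K n}. width brk n k * z n k) = m n (K n + 1) - m n 1" for n
    by (simp add: sum_Suc_diff)
  \<comment> \<open>As \<open>W\<close> lies between \<open>L\<close> and \<open>U\<close>, the
    telescoped sum is exactly \<open>W\<close> minus \<open>L\<close>.\<close>
  then have W: "W P n x = L P n + (\<Sum>k\<in>{1..K n}. width brk n k * z n k)" for n
    using W_bounds[OF x, of n] brk(1,2)[of n] by (simp add: m_def)
  have x01: "x $ i = 0 \<or> x $ i = 1" for i
    using x by (simp add: feasible_def)
  have s: "s i n k \<in> {0..1} \<and> s i n k \<le> x $ i \<and> s i n k \<le> z n k \<and> x $ i + z n k - 1 \<le> s i n k"
    if "k \<in> {1..K n}" for i n k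
    using x01[of i] z01[OF that] by (auto simp: s_def)
  have "lfp_feasible P K brk (x, y, z, s)"
    unfolding lfp_feasible.simps
  proof (intro conjI allI ballI)
    show "outside_weight P n + (\<Sum>i\<in>UNIV. membership P i n * x $ i * weight P i)
        = L P n + (\<Sum>k\<in>{1..K n}. width brk n k * z n k)" for n
      using W[of n] by (simp add: W_def)
    show "y n k \<in> {0, 1}" for n k
      by (simp add: y_def)
  qed (use x s z01 y_le_z z_le_y y_mono in auto)
  then show thesis by (rule that)
qed

section \<open>The approximation guarantee\<close>

theorem theorem2:
  fixes P :: "('m::finite, 'n::finite, 'p::finite) cnl"
    and K :: "'n \<Rightarrow> nat" and brk :: "'n \<Rightarrow> nat \<Rightarrow> real"
    and fhat ghat :: "'n \<Rightarrow> real \<Rightarrow> real"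
    and \<epsilon> :: real
    and x_opt x_hat :: "real ^ 'm"
    and y_hat z_hat :: "'n \<Rightarrow> nat \<Rightarrow> real" and s_hat :: "'m \<Rightarrow> 'n \<Rightarrow> nat \<Rightarrow> real"
  assumes revenue: "\<And>i. 0 \<le> revenue P i"
    and weight: "\<And>i. 0 \<le> weight P i"
    and outside_weight: "\<And>n. 0 \<le> outside_weight P n"
    and membership: "\<And>i n. 0 \<le> membership P i n" "\<And>i. (\<Sum>n\<in>UNIV. membership P i n) = 1"
    and dissim: "\<And>n. dissim P n \<in> {0..1}"
    and L_pos: "\<And>n. 0 < L P n"
    and partition: "\<And>n. is_partition (L P n) (U P n) (K n) (brk n)"
    and fhat: "\<And>n. pw_linear_interpolant (K n) (brk n) (fn P n) (fhat n)"
    and ghat: "\<And>n. pw_linear_interpolant (K n) (brk n) (gn P n) (ghat n)"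
    and \<epsilon>: "0 < \<epsilon>" "\<epsilon> < 1"
    and fhat_error: "\<And>n. \<forall>t\<in>{L P n..U P n}. (fhat n t - fn P n t) / fn P n t \<le> \<epsilon>"
    and ghat_error: "\<And>n. \<forall>t\<in>{L P n..U P n}. (gn P n t - ghat n t) / gn P n t \<le> \<epsilon>"
    and x_opt: "is_arg_max (expected_revenue P) (\<lambda>x. x \<in> feasible P) x_opt"
    and x_hat: "is_arg_max (lfp_objective P K brk) (lfp_feasible P K brk)
                  (x_hat, y_hat, z_hat, s_hat)"
  shows "(expected_revenue P x_opt \<le> lfp_objective P K brk (x_hat, y_hat, z_hat, s_hat) \<and>
          lfp_objective P K brk (x_hat, y_hat, z_hat, s_hat)
            \<le> (1 + \<epsilon>) / (1 - \<epsilon>) * expected_revenue P x_opt) \<and>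
         ((1 - \<epsilon>) / (1 + \<epsilon>) * expected_revenue P x_opt \<le> expected_revenue P x_hat \<and>
          expected_revenue P x_hat \<le> expected_revenue P x_opt)"
proof -
  have ratio: "expected_revenue P x \<le> revenue_ratio P fhat ghat x \<and>
      revenue_ratio P fhat ghat x \<le> (1 + \<epsilon>) / (1 - \<epsilon>) * expected_revenue P x"
    if x: "x \<in> feasible P" for x
  proof -
    let ?N = "\<lambda>f. \<Sum>i\<in>UNIV. \<Sum>n\<in>UNIV. f n (W P n x) * membership P i n * x $ i * revenue P i * weight P i"
    let ?D = "\<lambda>g. \<Sum>n\<in>UNIV. g n (W P n x)"
    have W: "W P n x \<in> {L P n..U P n}" for n
      using W_bounds[OF x] .
    have brk: "brk n 1 = L P n" "brk n (K n + 1) = U P n"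
      "\<And>k. k \<in> {1..K n} \<Longrightarrow> brk n k < brk n (k + 1)" for n
      using partition[of n] by (auto simp: is_partition_def)
    \<comment> \<open>Positivity comes from \<open>L_pos\<close>; it allows the relative error
      bounds to be multiplied out.\<close>
    have pos: "0 < fn P n (W P n x)" "0 < gn P n (W P n x)" for n
      using W[of n] L_pos[of n] by (auto simp: fn_def gn_def)
    have interval: "{brk n 1..brk n (K n + 1)} \<subseteq> {0<..}" for n
      using brk(1)[of n] L_pos[of n] by auto
    have f_le: "fn P n (W P n x) \<le> fhat n (W P n x)" for n
    proof (rule convex_le_interpolant[OF fhat brk(3)])
      show "convex_on {brk n 1..brk n (K n + 1)} (fn P n)"
        unfolding fn_def using dissim[of n]
        by (intro convex_on_subset[OF convex_on_powr_nonpos interval]) auto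
    qed (use W brk in auto)
    have g_ge: "ghat n (W P n x) \<le> gn P n (W P n x)" for n
    proof (rule concave_ge_interpolant[OF ghat brk(3)])
      show "concave_on {brk n 1..brk n (K n + 1)} (gn P n)"
        using convex_on_subset[OF concave_on_powr[unfolded concave_on_def] interval] dissim[of n]
        by (auto simp: gn_def concave_on_def)
    qed (use W brk in auto)
    have f_ge: "fhat n (W P n x) \<le> (1 + \<epsilon>) * fn P n (W P n x)" for n
      using bspec[OF fhat_error W, of n] pos(1)[of n] by (simp add: pos_divide_le_eq algebra_simps)
    have g_le: "(1 - \<epsilon>) * gn P n (W P n x) \<le> ghat n (W P n x)" for n
      using bspec[OF ghat_error W, of n] pos(2)[of n] by (simp add: pos_divide_le_eq algebra_simps)
    have x_nonneg: "0 \<le> x $ i" for i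
      using x by (auto simp: feasible_def dest!: spec[of _ i])
    note nonneg = revenue weight membership(1) x_nonneg
    have N_nonneg: "0 \<le> ?N (fn P)"
      by (intro sum_nonneg mult_nonneg_nonneg nonneg less_imp_le[OF pos(1)])
    have N_le: "?N (fn P) \<le> ?N fhat"
      by (intro sum_mono mult_right_mono nonneg f_le)
    have "?N fhat \<le> ?N (\<lambda>n t. (1 + \<epsilon>) * fn P n t)"
      by (intro sum_mono mult_right_mono nonneg f_ge)
    also have "\<dots> = (1 + \<epsilon>) * ?N (fn P)"
      by (simp add: sum_distrib_left mult.assoc)
    finally have N_ge: "?N fhat \<le> (1 + \<epsilon>) * ?N (fn P)" .
    have D_pos: "0 < ?D (gn P)"
      by (intro sum_pos pos(2)) auto
    have D_ge: "?D ghat \<le> ?D (gn P)"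
      by (intro sum_mono g_ge)
    have D_le: "(1 - \<epsilon>) * ?D (gn P) \<le> ?D ghat"
      unfolding sum_distrib_left by (intro sum_mono g_le)
    \<comment> \<open>Here \<epsilon> < 1 enters: the lower bound for the approximate denominator is
      positive, so the quotients can be compared.\<close>
    have D_pos': "0 < (1 - \<epsilon>) * ?D (gn P)"
      using D_pos \<epsilon> by simp
    have "?N (fn P) / ?D (gn P) \<le> ?N fhat / ?D ghat"
      using N_nonneg N_le D_ge D_le D_pos' by (intro frac_le) auto
    moreover have "?N fhat / ?D ghat \<le> ((1 + \<epsilon>) * ?N (fn P)) / ((1 - \<epsilon>) * ?D (gn P))"
      using N_nonneg N_le N_ge D_le D_pos' by (intro frac_le) auto
    ultimately show ?thesis
      by (simp add: expected_revenue_eq revenue_ratio_def)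
  qed
  let ?Fhat = "lfp_objective P K brk (x_hat, y_hat, z_hat, s_hat)"
  note objective = lfp_objective_eq[OF _ partition fhat ghat]
  have hat_feasible: "lfp_feasible P K brk (x_hat, y_hat, z_hat, s_hat)"
    and hat_max: "\<And>v. lfp_feasible P K brk v \<Longrightarrow> lfp_objective P K brk v \<le> ?Fhat"
    using x_hat unfolding is_arg_max_linorder by blast+
  have opt_feasible: "x_opt \<in> feasible P"
    and opt_max: "\<And>x. x \<in> feasible P \<Longrightarrow> expected_revenue P x \<le> expected_revenue P x_opt"
    using x_opt unfolding is_arg_max_linorder by blast+
  have x_hat_feasible: "x_hat \<in> feasible P"
    using hat_feasible by simp
  have Fhat: "?Fhat = revenue_ratio P fhat ghat x_hat"
    using objective[OF hat_feasible] .
  \<comment> \<open>Lifting \<open>x_opt\<close> to a feasible point of the program makes it a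
    competitor of the optimal \<open>x_hat\<close>.\<close>
  obtain y z s where opt_lift: "lfp_feasible P K brk (x_opt, y, z, s)"
    using lfp_feasible_exists[OF opt_feasible partition] .
  have lower: "expected_revenue P x_opt \<le> ?Fhat"
    using ratio[OF opt_feasible] hat_max[OF opt_lift] objective[OF opt_lift] by simp
  have upper: "?Fhat \<le> (1 + \<epsilon>) / (1 - \<epsilon>) * expected_revenue P x_hat"
    using ratio[OF x_hat_feasible] Fhat by simp
  have le: "expected_revenue P x_hat \<le> expected_revenue P x_opt"
    using opt_max[OF x_hat_feasible] .
  have "(1 + \<epsilon>) / (1 - \<epsilon>) * expected_revenue P x_hat \<le> (1 + \<epsilon>) / (1 - \<epsilon>) * expected_revenue P x_opt"
    using le \<epsilon> by (intro mult_left_mono) auto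
  \<comment> \<open>Chaining \<open>lower\<close> and \<open>upper\<close> eliminates the program's
    optimal value; the factor is then moved to the other side.\<close>
  moreover have "(1 - \<epsilon>) / (1 + \<epsilon>) * expected_revenue P x_opt \<le> expected_revenue P x_hat"
    using order_trans[OF lower upper] \<epsilon> by (simp add: field_simps)
  ultimately show ?thesis
    using lower upper le by linarith
qed

end
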